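(* Let $n$ be an integer, let $R$ be an incidence structure and let $P$ be a poset. Then: (1) $R\in\mathcal{F}_{\mathcal{S}}(n)$ if and only if $Gal(R)\in\mathcal{L}_{\mathcal{S}}(n)$; (2) $P\in\mathcal{I}_{\mathcal{S}}(n)$ if and only if $Gal((P,<,P))\in\mathcal{L}_{\mathcal{S}}(n)$; (3) $P\in\mathcal{L}_{\mathcal{S}}(n)$ if and only if $N(P)\in\mathcal{L}_{\mathcal{S}}(n)$.
   Context: A poset is scattered if it contains no induced subposet isomorphic to the chain of rational numbers. An incidence structure is a triple $R=(E,\rho,F)$ with $\rho\subseteq E\times F$. For $Y\subseteq F$, $L_R(Y):=\{x\in E: x\rho y\text{ for all }y\in Y\}$, and the Galois lattice is $Gal(R):=\{L_R(Y):Y\subseteq F\}$ ordered by inclusion. For a poset $P$, $N(P):=Gal((P,\leq,P))$ is its MacNeille completion, and $<$ denotes the strict order of $P$. For an integer $n$: $\mathcal{L}_{\mathcal{S}}(n)$ is the class of posets whose order is the intersection of at most $n$ scattered linear orders on the underlying set. $\mathcal{F}_{\mathcal{S}}(n)$ is the class of incidence structures $(E,\rho,F)$ such that $\rho$ is the intersection of at most $n$ relations $\rho'\subseteq E\times F$ such that $Gal((E,\rho',F))$ is a scattered chain. $\mathcal{I}_{\mathcal{S}}(n)$ is the class of posets $P$ whose order is the intersection of at most $n$ orders $\leq'$ on $P$ such that, with $<'$ the strict order associated with $\leq'$, $Gal((P,<',P))$ is a scattered chain. *)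

theory Defs
  imports Complex_Main
begin

text \<open>A poset is a pair of a carrier set and a (reflexive) order relation on it; an incidence
  structure is a triple of two sets and a relation between them.\<close>

type_synonym 'a poset = "'a set \<times> 'a rel"

fun poset :: "'a poset \<Rightarrow> bool" where
  "poset (A, r) \<longleftrightarrow> partial_order_on A r"

fun chain :: "'a poset \<Rightarrow> bool" where
  "chain (A, r) \<longleftrightarrow> linear_order_on A r"

fun scattered :: "'a poset \<Rightarrow> bool" where
  "scattered (A, r) \<longleftrightarrow>
     \<not> (\<exists>B f. B \<subseteq> A \<and> bij_betw f (UNIV :: rat set) B \<and> (\<forall>x y. x \<le> y \<longleftrightarrow> (f x, f y) \<in> r))"

type_synonym ('a, 'b) incidence = "'a set \<times> ('a \<times> 'b) set \<times> 'b set"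

fun incidence_structure :: "('a, 'b) incidence \<Rightarrow> bool" where
  "incidence_structure (E, \<rho>, F) \<longleftrightarrow> \<rho> \<subseteq> E \<times> F"

fun lower :: "('a, 'b) incidence \<Rightarrow> 'b set \<Rightarrow> 'a set" where
  "lower (E, \<rho>, F) Y = {x \<in> E. \<forall>y \<in> Y. (x, y) \<in> \<rho>}"

fun Gal_carrier :: "('a, 'b) incidence \<Rightarrow> 'a set set" where
  "Gal_carrier (E, \<rho>, F) = {lower (E, \<rho>, F) Y | Y. Y \<subseteq> F}"

definition Gal :: "('a, 'b) incidence \<Rightarrow> 'a set poset" where
  "Gal R = (Gal_carrier R, relation_of (\<subseteq>) (Gal_carrier R))"

fun MacNeille :: "'a poset \<Rightarrow> 'a set poset" where
  "MacNeille (A, r) = Gal (A, r, A)"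

fun strict_incidence :: "'a poset \<Rightarrow> ('a, 'a) incidence" where
  "strict_incidence (A, r) = (A, r - Id, A)"

text \<open>The family is required to be nonempty. For \<open>n \<ge> 1\<close> this excludes nothing in the three
  classes below: there the empty intersection would be the full relation, which, whenever it is
  admissible, is itself a member of the family over which one intersects. For \<open>n \<le> 0\<close> the
  classes are empty.\<close>

definition inter_of_at_most :: "int \<Rightarrow> ('c set \<Rightarrow> bool) \<Rightarrow> 'c set \<Rightarrow> bool" where
  "inter_of_at_most n Q r \<longleftrightarrow>
     (\<exists>S. S \<noteq> {} \<and> finite S \<and> int (card S) \<le> n \<and> (\<forall>s \<in> S. Q s) \<and> r = \<Inter>S)"

definition L_S :: "int \<Rightarrow> 'a poset set" where
  "L_S n = {(A, r). poset (A, r) \<and>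
     inter_of_at_most n (\<lambda>l. chain (A, l) \<and> scattered (A, l)) r}"

definition F_S :: "int \<Rightarrow> ('a, 'b) incidence set" where
  "F_S n = {(E, \<rho>, F). incidence_structure (E, \<rho>, F) \<and>
     inter_of_at_most n
       (\<lambda>\<rho>'. \<rho>' \<subseteq> E \<times> F \<and> chain (Gal (E, \<rho>', F)) \<and> scattered (Gal (E, \<rho>', F))) \<rho>}"

definition I_S :: "int \<Rightarrow> 'a poset set" where
  "I_S n = {(A, r). poset (A, r) \<and>
     inter_of_at_most n
       (\<lambda>r'. poset (A, r') \<and> chain (Gal (strict_incidence (A, r')))
         \<and> scattered (Gal (strict_incidence (A, r')))) r}"

end

theory Submission
  imports Defs "HOL-Library.Countable"
begin

text \<open>Each lattice \<open>Gal(R)\<close> embeds into the product of the \<open>Gal(\<rho>')\<close> whenever \<open>\<rho>\<close> is the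
  intersection of the \<open>\<rho>'\<close>, since \<open>X\<close> is determined by its closures with respect to the
  \<open>\<rho>'\<close>; these closures give total preorders, which are refined lexicographically to scattered
  linear orders. Conversely \<open>x \<rho> y\<close> holds iff the closure of \<open>{x}\<close> lies below the down-set
  of \<open>y\<close>, so every linear extension \<open>l\<close> of \<open>Gal(R)\<close> defines a relation on
  \<open>E \<times> F\<close>. The members of its Galois lattice are cut out by \<open>l\<close>, and a rational chain of
  such cuts yields a rational chain in \<open>l\<close> by choosing elements between cuts.\<close>

section \<open>Scattered orders and scattered total preorders\<close>

declare chain.simps [simp del] and scattered.simps [simp del]

text \<open>Stated with the strict part of \<open>r\<close>, so that it also makes sense for
  preorders, where distinct elements may be tied.\<close>

definition rat_free :: "'a rel \<Rightarrow> bool" where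
  "rat_free r \<longleftrightarrow> \<not> (\<exists>f :: rat \<Rightarrow> 'a. \<forall>x y. x < y \<longrightarrow> (f x, f y) \<in> r \<and> (f y, f x) \<notin> r)"

lemma rat_freeD:
  fixes f :: "rat \<Rightarrow> 'a"
  assumes "rat_free r" "\<And>x y. x < y \<Longrightarrow> (f x, f y) \<in> r \<and> (f y, f x) \<notin> r"
  shows False
  using assms unfolding rat_free_def by blast

definition scattered_preorder :: "'a set \<Rightarrow> 'a rel \<Rightarrow> bool" where
  "scattered_preorder A r \<longleftrightarrow> r \<subseteq> A \<times> A \<and> trans r \<and>
     (\<forall>x\<in>A. \<forall>y\<in>A. (x, y) \<in> r \<or> (y, x) \<in> r) \<and> rat_free r"

lemma scattered_preorderD:
  assumes "scattered_preorder A r"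
  shows "r \<subseteq> A \<times> A" "trans r" "\<And>x y. x \<in> A \<Longrightarrow> y \<in> A \<Longrightarrow> (x, y) \<in> r \<or> (y, x) \<in> r"
    "\<And>x. x \<in> A \<Longrightarrow> (x, x) \<in> r" "rat_free r"
  using assms by (auto simp: scattered_preorder_def)

text \<open>The rationals form a chain, so a map that sends \<open><\<close> to the strict part of
  \<open>r\<close> also reflects the order and is injective.\<close>

lemma scattered_iff_rat_free:
  assumes "partial_order_on A r"
  shows "scattered (A, r) \<longleftrightarrow> rat_free r"
proof
  assume s: "scattered (A, r)"
  show "rat_free r"
    unfolding rat_free_def
  proof
    assume "\<exists>f :: rat \<Rightarrow> 'a. \<forall>x y. x < y \<longrightarrow> (f x, f y) \<in> r \<and> (f y, f x) \<notin> r"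
    then obtain f :: "rat \<Rightarrow> 'a" where f: "\<And>x y. x < y \<Longrightarrow> (f x, f y) \<in> r \<and> (f y, f x) \<notin> r"
      by blast
    have A: "f x \<in> A" for x
      using f[of x "x + 1"] assms by (auto simp: partial_order_on_def preorder_on_def)
    then have refl: "(f x, f x) \<in> r" for x
      using assms by (auto simp: partial_order_on_def preorder_on_def refl_on_def)
    have iff: "x \<le> y \<longleftrightarrow> (f x, f y) \<in> r" for x y
      using f[of x y] f[of y x] refl[of x] by (cases x y rule: linorder_cases) auto
    have "inj f"
      by (metis f injI linorder_neqE)
    then have "bij_betw f UNIV (range f)"
      by (simp add: inj_on_imp_bij_betw)
    moreover have "range f \<subseteq> A"
      using A by blast
    ultimately show False
      using iff s unfolding scattered.simps by blast
  qed
next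
  assume r: "rat_free r"
  show "scattered (A, r)"
    unfolding scattered.simps
  proof
    assume "\<exists>B f. B \<subseteq> A \<and> bij_betw f (UNIV :: rat set) B \<and> (\<forall>x y. x \<le> y \<longleftrightarrow> (f x, f y) \<in> r)"
    then obtain f :: "rat \<Rightarrow> 'a" where "\<And>x y. x \<le> y \<longleftrightarrow> (f x, f y) \<in> r"
      by blast
    then have "\<forall>x y. x < y \<longrightarrow> (f x, f y) \<in> r \<and> (f y, f x) \<notin> r"
      by (metis less_le_not_le)
    with r show False
      unfolding rat_free_def by blast
  qed
qed

lemma scattered_chain_iff:
  "chain (A, r) \<and> scattered (A, r) \<longleftrightarrow> scattered_preorder A r \<and> antisym r"
proof -
  have "refl_on A r \<and> total_on A r \<longleftrightarrow> (\<forall>x\<in>A. \<forall>y\<in>A. (x, y) \<in> r \<or> (y, x) \<in> r)"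
    unfolding refl_on_def total_on_def by metis
  then have "linear_order_on A r \<longleftrightarrow> r \<subseteq> A \<times> A \<and> trans r \<and>
     (\<forall>x\<in>A. \<forall>y\<in>A. (x, y) \<in> r \<or> (y, x) \<in> r) \<and> antisym r"
    unfolding linear_order_on_def partial_order_on_def preorder_on_def by argo
  then show ?thesis
    using scattered_iff_rat_free[of A r]
    by (auto simp: scattered_preorder_def linear_order_on_def chain.simps)
qed

text \<open>Strict pairs of the pullback are mapped by \<open>f\<close> to strict pairs of
  \<open>r\<close>. As \<open>f\<close> may identify points, this produces preorders rather than
  orders.\<close>

lemma scattered_preorder_pullback:
  assumes "scattered_preorder B r" and "f ` A \<subseteq> B"
  shows "scattered_preorder A {(x, y) \<in> A \<times> A. (f x, f y) \<in> r}"
proof -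
  note r = scattered_preorderD[OF assms(1)]
  have "rat_free {(x, y) \<in> A \<times> A. (f x, f y) \<in> r}" (is "rat_free ?r")
    unfolding rat_free_def
  proof
    assume "\<exists>g :: rat \<Rightarrow> _. \<forall>x y. x < y \<longrightarrow> (g x, g y) \<in> ?r \<and> (g y, g x) \<notin> ?r"
    then obtain g :: "rat \<Rightarrow> _" where "\<forall>x y. x < y \<longrightarrow> (g x, g y) \<in> ?r \<and> (g y, g x) \<notin> ?r"
      by blast
    then show False
      by (intro rat_freeD[OF r(5), of "\<lambda>x. f (g x)"]) auto
  qed
  moreover have "trans ?r"
    using r(2) by (auto simp: trans_def)
  moreover have "\<forall>x\<in>A. \<forall>y\<in>A. (x, y) \<in> ?r \<or> (y, x) \<in> ?r"
    using r(3) assms(2) by auto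
  ultimately show ?thesis
    by (auto simp: scattered_preorder_def)
qed

section \<open>Lexicographic refinement\<close>

definition lex_refine :: "'a rel \<Rightarrow> 'a rel \<Rightarrow> 'a rel" where
  "lex_refine r s = {(x, y) \<in> r. (y, x) \<in> r \<longrightarrow> (x, y) \<in> s}"

text \<open>If some interval of the rationals is collapsed by \<open>r\<close>, that interval contains a
  copy of the rationals, which is embedded in \<open>s\<close>.\<close>

lemma rat_free_lex_refine:
  assumes "trans r" "rat_free r" "rat_free s"
  shows "rat_free (lex_refine r s)"
  unfolding rat_free_def
proof
  assume "\<exists>f :: rat \<Rightarrow> 'a. \<forall>x y. x < y \<longrightarrow> (f x, f y) \<in> lex_refine r s \<and> (f y, f x) \<notin> lex_refine r s"
  then obtain f :: "rat \<Rightarrow> 'a"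
    where f: "\<And>x y. x < y \<Longrightarrow> (f x, f y) \<in> lex_refine r s \<and> (f y, f x) \<notin> lex_refine r s"
    by blast
  then have fr: "\<And>x y. x < y \<Longrightarrow> (f x, f y) \<in> r"
    by (auto simp: lex_refine_def)
  \<comment> \<open>If no such pair existed, \<open>f\<close> itself would be a rational chain in
    \<open>r\<close>.\<close>
  obtain a b where ab: "a < b" "(f b, f a) \<in> r"
    using assms(2) fr unfolding rat_free_def by blast
  \<comment> \<open>The map \<open>x / (1 + \<bar>x\<bar>)\<close> squeezes the rationals
    increasingly into (-1, 1); an affine map carries this into (a, b).\<close>
  define h where "h x = a + (b - a) * ((1 + x / (1 + \<bar>x\<bar>)) / 2)" for x :: rat
  have h_mono: "h x < h y" if "x < y" for x y
  proof -
    have "x * \<bar>y\<bar> \<le> y * \<bar>x\<bar>"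
      using that by (auto simp: abs_if mult_le_0_iff zero_le_mult_iff)
    then have "x * (1 + \<bar>y\<bar>) < y * (1 + \<bar>x\<bar>)"
      using that by (simp add: algebra_simps)
    then have "x / (1 + \<bar>x\<bar>) < y / (1 + \<bar>y\<bar>)"
      by (subst frac_less_eq) (auto simp: divide_simps)
    then show ?thesis
      using ab(1) by (simp add: h_def)
  qed
  have h_in: "a < h x" "h x < b" for x
  proof -
    have "-1 < x / (1 + \<bar>x\<bar>)" "x / (1 + \<bar>x\<bar>) < 1"
      by (auto simp: field_simps)
    then have "0 < (1 + x / (1 + \<bar>x\<bar>)) / 2" "(1 + x / (1 + \<bar>x\<bar>)) / 2 < 1"
      by auto
    then have "0 < (b - a) * ((1 + x / (1 + \<bar>x\<bar>)) / 2)" "(b - a) * ((1 + x / (1 + \<bar>x\<bar>)) / 2) < b - a"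
      using ab(1) by (simp_all only: mult_less_cancel_left2 zero_less_mult_iff diff_gt_0_iff_gt simp_thms) auto
    then show "a < h x" "h x < b"
      unfolding h_def by linarith+
  qed
  \<comment> \<open>Going up from \<open>f (h y)\<close> to \<open>f b\<close>, across to
    \<open>f a\<close>, and up to \<open>f (h x)\<close> shows that all these points are tied in
    \<open>r\<close>, so \<open>s\<close> decides.\<close>
  have rev: "(f (h y), f (h x)) \<in> r" for x y
    using fr[OF h_in(1)] fr[OF h_in(2)] ab(2) transD[OF assms(1)] by meson
  have "(f (h x), f (h y)) \<in> s \<and> (f (h y), f (h x)) \<notin> s" if "x < y" for x y
    using f[OF h_mono[OF that]] rev by (auto simp: lex_refine_def)
  then show False
    by (rule rat_freeD[OF assms(3)])
qed

lemma scattered_preorder_lex_refine: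
  assumes "scattered_preorder A r" "scattered_preorder A s"
  shows "scattered_preorder A (lex_refine r s)"
proof -
  note r = scattered_preorderD[OF assms(1)] and s = scattered_preorderD[OF assms(2)]
  have "trans (lex_refine r s)"
  proof (rule transI)
    fix x y z
    assume "(x, y) \<in> lex_refine r s" "(y, z) \<in> lex_refine r s"
    then show "(x, z) \<in> lex_refine r s"
      using transD[OF r(2), of x y z] transD[OF r(2), of y z x] transD[OF r(2), of z x y]
        transD[OF s(2), of x y z]
      by (auto simp: lex_refine_def)
  qed
  moreover have "lex_refine r s \<subseteq> A \<times> A"
    using r(1) by (auto simp: lex_refine_def)
  moreover have "\<forall>x\<in>A. \<forall>y\<in>A. (x, y) \<in> lex_refine r s \<or> (y, x) \<in> lex_refine r s"
    using r(3) s(3) unfolding lex_refine_def by blast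
  ultimately show ?thesis
    using rat_free_lex_refine[OF r(2,5) s(5)] by (simp add: scattered_preorder_def)
qed

text \<open>Refine the members lexicographically one after another: a tie in the result is a tie in
  each of them. If \<open>\<Inter>S\<close> is antisymmetric, \<open>m\<close> is therefore
  linear.\<close>

lemma ex_scattered_preorder_extending_Inter:
  assumes "finite S" "S \<noteq> {}" "\<forall>s\<in>S. scattered_preorder A s"
  shows "\<exists>m. scattered_preorder A m \<and> \<Inter>S \<subseteq> m \<and> (\<forall>x y. (x, y) \<in> m \<and> (y, x) \<in> m \<longrightarrow> (x, y) \<in> \<Inter>S)"
  using assms
proof (induction rule: finite_ne_induct)
  case (singleton s)
  then show ?case
    by (intro exI[of _ s]) simp
next
  case (insert s S)
  from insert.IH insert.prems obtain m where m: "scattered_preorder A m" "\<Inter>S \<subseteq> m"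
    "\<forall>x y. (x, y) \<in> m \<and> (y, x) \<in> m \<longrightarrow> (x, y) \<in> \<Inter>S"
    by (meson insertCI)
  show ?case
  proof (intro exI conjI allI impI)
    show "scattered_preorder A (lex_refine s m)"
      using insert.prems m(1) by (simp add: scattered_preorder_lex_refine)
    show "\<Inter>(insert s S) \<subseteq> lex_refine s m"
      using m(2) unfolding lex_refine_def by blast
    fix x y assume "(x, y) \<in> lex_refine s m \<and> (y, x) \<in> lex_refine s m"
    then have "(x, y) \<in> s" "(x, y) \<in> m" "(y, x) \<in> m"
      by (simp_all add: lex_refine_def)
    moreover from this have "(x, y) \<in> \<Inter>S"
      using m(3)[rule_format, OF conjI] by iprover
    ultimately show "(x, y) \<in> \<Inter>(insert s S)"
      by simp
  qed
qed

section \<open>Intersections of at most n relations\<close>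

text \<open>The image of a finite family is no larger than the family. Transfers between the classes
  reduce to choosing \<open>h\<close> and checking one relation and one intersection.\<close>

lemma inter_of_at_most_map:
  assumes "inter_of_at_most n Q r"
    and "\<And>s. Q s \<Longrightarrow> Q' (h s)"
    and "\<And>S. S \<noteq> {} \<Longrightarrow> \<forall>s\<in>S. Q s \<Longrightarrow> r = \<Inter>S \<Longrightarrow> r' = \<Inter>(h ` S)"
  shows "inter_of_at_most n Q' r'"
proof -
  obtain S where S: "S \<noteq> {}" "finite S" "int (card S) \<le> n" "\<forall>s\<in>S. Q s" "r = \<Inter>S"
    using assms(1) unfolding inter_of_at_most_def by blast
  moreover have "int (card (h ` S)) \<le> n"
    using card_image_le[OF S(2), of h] S(3) by linarith
  ultimately show ?thesis
    unfolding inter_of_at_most_def using assms(2,3) by (intro exI[of _ "h ` S"]) auto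
qed

text \<open>Ties of each preorder are broken by a fixed lexicographic combination of all of them.\<close>

lemma L_S_if_inter_of_scattered_preorders:
  assumes "partial_order_on A r" "inter_of_at_most n (scattered_preorder A) r"
  shows "(A, r) \<in> L_S n"
proof -
  obtain S where S: "S \<noteq> {}" "finite S" "int (card S) \<le> n" "\<forall>s\<in>S. scattered_preorder A s" "r = \<Inter>S"
    using assms(2) unfolding inter_of_at_most_def by blast
  obtain m where m: "scattered_preorder A m" "r \<subseteq> m" "\<forall>x y. (x, y) \<in> m \<and> (y, x) \<in> m \<longrightarrow> (x, y) \<in> r"
    using ex_scattered_preorder_extending_Inter[OF S(2,1,4)] S(5) by blast
  have "antisym m"
    using m(3) assms(1) by (auto simp: antisym_def partial_order_on_def)
  then have "antisym (lex_refine s m)" for s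
    by (auto simp: antisym_def lex_refine_def)
  then have "\<forall>s\<in>S. chain (A, lex_refine s m) \<and> scattered (A, lex_refine s m)"
    unfolding scattered_chain_iff using S(4) m(1) by (simp add: scattered_preorder_lex_refine)
  \<comment> \<open>Refinement only shrinks \<open>s\<close>, and it loses no pair of
    \<open>r\<close> because \<open>r \<subseteq> m\<close>.\<close>
  moreover have "r = \<Inter>((\<lambda>s. lex_refine s m) ` S)"
    using S(1,5) m(2) by (auto simp: lex_refine_def)
  moreover have "int (card ((\<lambda>s. lex_refine s m) ` S)) \<le> n"
    using card_image_le[OF S(2), of "\<lambda>s. lex_refine s m"] S(3) by linarith
  ultimately have "inter_of_at_most n (\<lambda>l. chain (A, l) \<and> scattered (A, l)) r"
    unfolding inter_of_at_most_def using S(1,2)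
    by (intro exI[of _ "(\<lambda>s. lex_refine s m) ` S"]) blast
  then show ?thesis
    using assms(1) by (simp add: L_S_def)
qed

text \<open>Lets later constructions supply total preorders with ties in place of linear
  orders.\<close>

lemma L_S_iff:
  "(A, r) \<in> L_S n \<longleftrightarrow> partial_order_on A r \<and> inter_of_at_most n (scattered_preorder A) r"
proof
  assume "(A, r) \<in> L_S n"
  then have r: "partial_order_on A r" "inter_of_at_most n (\<lambda>l. chain (A, l) \<and> scattered (A, l)) r"
    by (auto simp: L_S_def)
  have "inter_of_at_most n (scattered_preorder A) r"
    by (rule inter_of_at_most_map[OF r(2), where h = id]) (simp_all add: scattered_chain_iff)
  with r(1) show "partial_order_on A r \<and> inter_of_at_most n (scattered_preorder A) r" by simp
qed (simp add: L_S_if_inter_of_scattered_preorders)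

section \<open>Disjoint rational intervals indexed by the rationals\<close>

text \<open>The increasing function \<open>h\<close> that jumps at every rational \<open>x\<close> by
  \<open>2\<^sup>-\<^sup>k\<close>, where \<open>k\<close> is the code of \<open>x\<close>, leaves a gap above each \<open>h x\<close>.\<close>

lemma ex_disjoint_rat_intervals:
  obtains a b :: "rat \<Rightarrow> rat" where "\<And>x. a x < b x" "\<And>x y. x < y \<Longrightarrow> b x < a y"
proof -
  define w where "w x n = (if \<exists>q<x. to_nat q = n then (1/2) ^ n else 0 :: real)" for x :: rat and n
  define h where "h x = suminf (w x)" for x
  have summ: "summable (w x)" for x
    by (rule summable_comparison_test[OF _ summable_geometric[of "1/2 :: real"]]) (auto simp: w_def)
  \<comment> \<open>The weight of \<open>x\<close> itself is counted in \<open>h y\<close> but not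
    in \<open>h x\<close>.\<close>
  have jump: "h x + (1/2) ^ to_nat x \<le> h y" if "x < y" for x y
  proof -
    define d where "d n = (if n = to_nat x then (1/2) ^ n else 0 :: real)" for n
    have "(\<lambda>n. w x n + d n) sums (h x + (1/2) ^ to_nat x)"
      unfolding h_def d_def by (intro sums_add summable_sums summ sums_single)
    moreover have "w y sums h y"
      unfolding h_def by (intro summable_sums summ)
    moreover have "w x n + d n \<le> w y n" for n
    proof (cases "n = to_nat x")
      case True
      then have "w x n = 0" "w y n = (1/2) ^ n"
        using that by (auto simp: w_def)
      with True show ?thesis
        by (simp add: d_def)
    next
      case False
      have "w x n \<le> w y n"
      proof (cases "\<exists>q<x. to_nat q = n")
        case True
        then obtain q where "q < x" "to_nat q = n"
          by (elim exE conjE)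
        then have "\<exists>q<y. to_nat q = n"
          using that by (intro exI[of _ q] conjI) simp_all
        then show ?thesis
          unfolding w_def by (simp only: True if_True)
      next
        case False
        then show ?thesis
          unfolding w_def by (simp only: if_False) simp
      qed
      with False show ?thesis
        by (simp add: d_def)
    qed
    ultimately show ?thesis
      by (rule sums_le[rotated])
  qed
  \<comment> \<open>Both endpoints fit into the gap above \<open>h x\<close>; for
    \<open>x < y\<close> the gap ends at or below \<open>h y\<close>, hence below
    \<open>a y\<close>.\<close>
  have "\<exists>a b :: rat. h x < of_rat a \<and> a < b \<and> of_rat b < h x + (1/2) ^ to_nat x" for x
  proof -
    obtain a where a: "h x < of_rat a" "of_rat a < h x + (1/2) ^ to_nat x"
      using of_rat_dense[of "h x" "h x + (1/2) ^ to_nat x"] by auto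
    obtain b where "real_of_rat a < of_rat b" "of_rat b < h x + (1/2) ^ to_nat x"
      using of_rat_dense[OF a(2)] by auto
    with a show ?thesis
      by (auto simp: of_rat_less)
  qed
  then obtain a b where ab: "\<And>x. h x < of_rat (a x) \<and> a x < b x \<and> of_rat (b x) < h x + (1/2) ^ to_nat x"
    by metis
  have "b x < a y" if "x < y" for x y
    using jump[OF that] ab[of x] ab[of y] of_rat_less[of "b x" "a y", where 'a = real] by linarith
  with ab that show thesis
    by blast
qed

section \<open>Galois lattices that are scattered chains\<close>

lemma partial_order_Gal: "partial_order_on (Gal_carrier R) (relation_of (\<subseteq>) (Gal_carrier R))"
  by (rule partial_order_on_relation_ofI) auto

lemma scattered_chain_Gal_iff:
  "chain (Gal R) \<and> scattered (Gal R) \<longleftrightarrow> scattered_preorder (Gal_carrier R) (snd (Gal R))"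
  using partial_order_Gal[of R] by (simp add: Gal_def scattered_chain_iff partial_order_on_def)

lemma lower_in_Gal_carrier: "Y \<subseteq> F \<Longrightarrow> lower (E, \<rho>, F) Y \<in> Gal_carrier (E, \<rho>, F)"
  by auto

text \<open>By \<open>mono\<close>, the set of elements related to \<open>y\<close> grows as
  \<open>\<phi> y\<close> moves up in \<open>l\<close>. Intersections of such sets are then nested,
  and a rational chain of them would yield one in \<open>l\<close>.\<close>

lemma scattered_chain_Gal_if_scattered_preorder:
  assumes l: "scattered_preorder C l" and \<phi>: "\<phi> ` F \<subseteq> C"
    and mono: "\<And>x y z. y \<in> F \<Longrightarrow> z \<in> F \<Longrightarrow> (\<phi> y, \<phi> z) \<in> l \<Longrightarrow> (x, y) \<in> \<rho> \<Longrightarrow> (x, z) \<in> \<rho>"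
  shows "chain (Gal (E, \<rho>, F)) \<and> scattered (Gal (E, \<rho>, F))"
proof -
  let ?G = "Gal_carrier (E, \<rho>, F)" and ?L = "lower (E, \<rho>, F)"
  note l = scattered_preorderD[OF l]
  have total: "(\<phi> y, \<phi> z) \<in> l \<or> (\<phi> z, \<phi> y) \<in> l" if "y \<in> F" "z \<in> F" for y z
    using that \<phi> l(3) by blast
  have "?L Y \<subseteq> ?L Z \<or> ?L Z \<subseteq> ?L Y" if "Y \<subseteq> F" "Z \<subseteq> F" for Y Z
  \<comment> \<open>Either every element of \<open>Z\<close> has one of \<open>Y\<close> below it,
    or by totality some element of \<open>Z\<close> lies below all of \<open>Y\<close>.\<close>
  proof (cases "\<forall>z\<in>Z. \<exists>y\<in>Y. (\<phi> y, \<phi> z) \<in> l")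
    case True
    then have "?L Y \<subseteq> ?L Z"
      using that mono by (auto 0 4 simp: subset_iff)
    then show ?thesis ..
  next
    case False
    then have "\<exists>z\<in>Z. \<forall>y\<in>Y. (\<phi> z, \<phi> y) \<in> l"
      using total that by blast
    then have "?L Z \<subseteq> ?L Y"
      using that mono by (auto 0 4 simp: subset_iff)
    then show ?thesis ..
  qed
  then have "\<forall>X\<in>?G. \<forall>Y\<in>?G. X \<subseteq> Y \<or> Y \<subseteq> X"
    by (auto simp del: lower.simps)
  moreover have "rat_free (relation_of (\<subseteq>) ?G)"
    unfolding rat_free_def
  proof
    assume "\<exists>I :: rat \<Rightarrow> _. \<forall>x y. x < y \<longrightarrow>
      (I x, I y) \<in> relation_of (\<subseteq>) ?G \<and> (I y, I x) \<notin> relation_of (\<subseteq>) ?G"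
    then obtain I where I: "\<And>x y :: rat. x < y \<Longrightarrow> I x \<in> ?G \<and> I y \<in> ?G \<and> I x \<subset> I y"
      unfolding relation_of_def by (auto simp: less_le_not_le simp del: Gal_carrier.simps)
    have "\<exists>Y. Y \<subseteq> F \<and> I x = ?L Y" for x
      using I[of x "x + 1"] by auto
    then obtain Y where Y: "\<And>x. Y x \<subseteq> F" "\<And>x. I x = ?L (Y x)"
      by metis
    \<comment> \<open>Each rational gets its own pair of cuts; disjointness of the intervals makes
      the witnesses chosen between them strictly ordered.\<close>
    obtain a b :: "rat \<Rightarrow> rat" where ab: "\<And>x. a x < b x" "\<And>x y. x < y \<Longrightarrow> b x < a y"
      using ex_disjoint_rat_intervals by blast
    have "\<exists>e y. e \<in> I (b x) \<and> y \<in> Y (a x) \<and> (e, y) \<notin> \<rho>" for x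
    proof -
      obtain e where "e \<in> I (b x)" "e \<notin> I (a x)"
        using I[OF ab(1)[of x]] by blast
      then show ?thesis
        unfolding Y(2) by auto
    qed
    then obtain e y where ey: "\<And>x. e x \<in> I (b x)" "\<And>x. y x \<in> Y (a x)" "\<And>x. (e x, y x) \<notin> \<rho>"
      by metis
    have yF: "y x \<in> F" for x
      using ey(2) Y(1) by blast
    \<comment> \<open>As \<open>b x < a z\<close>, the element \<open>e x\<close> is related to
      \<open>y z\<close> but not to \<open>y x\<close>, so \<open>mono\<close> forbids
      \<open>\<phi> (y z)\<close> below \<open>\<phi> (y x)\<close>.\<close>
    have "(\<phi> (y x), \<phi> (y z)) \<in> l \<and> (\<phi> (y z), \<phi> (y x)) \<notin> l" if "x < z" for x z
    proof -
      have "e x \<in> I (a z)"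
        using I[OF ab(2)[OF that]] ey(1)[of x] by blast
      then have "(e x, y z) \<in> \<rho>"
        using ey(2)[of z] unfolding Y(2) by auto
      then have "(\<phi> (y z), \<phi> (y x)) \<notin> l"
        using mono[OF yF yF] ey(3) by blast
      then show ?thesis
        using total[OF yF yF] by blast
    qed
    then show False
      by (rule rat_freeD[OF l(5)])
  qed
  moreover have "relation_of (\<subseteq>) ?G \<subseteq> ?G \<times> ?G" "trans (relation_of (\<subseteq>) ?G)"
    using partial_order_Gal[of "(E, \<rho>, F)"] by (simp_all add: partial_order_on_def preorder_on_def)
  ultimately show ?thesis
    unfolding scattered_chain_Gal_iff scattered_preorder_def
    by (simp add: Gal_def relation_of_def del: Gal_carrier.simps)
qed

section \<open>Closures and the class F_S\<close>

text \<open>The Galois closure: for \<open>X \<subseteq> E\<close>, the least member of the lattice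
  containing \<open>X\<close>.\<close>

definition closure_of :: "('a, 'b) incidence \<Rightarrow> 'a set \<Rightarrow> 'a set" where
  "closure_of R X = lower R {y \<in> snd (snd R). \<forall>x\<in>X. (x, y) \<in> fst (snd R)}"

lemma closure_of_in_Gal_carrier: "closure_of R X \<in> Gal_carrier R"
  by (cases R) (auto simp: closure_of_def simp del: lower.simps)

lemma singleton_closure_subset_iff:
  assumes "x \<in> E" "y \<in> F"
  shows "closure_of (E, \<rho>, F) {x} \<subseteq> lower (E, \<rho>, F) {y} \<longleftrightarrow> (x, y) \<in> \<rho>"
  using assms by (auto simp: closure_of_def)

text \<open>Let \<open>Z\<close> be cut out by \<open>Y\<close>. For each \<open>s\<close> the
  closure of \<open>Z\<close> still satisfies every condition in \<open>Y\<close>, and it contains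
  \<open>X\<close>; so \<open>X\<close> satisfies these conditions for all \<open>s\<close>.\<close>

lemma closures_subset_iff:
  assumes "S \<noteq> {}" "X \<in> Gal_carrier (E, \<Inter>S, F)" "Z \<in> Gal_carrier (E, \<Inter>S, F)"
  shows "(\<forall>s\<in>S. closure_of (E, s, F) X \<subseteq> closure_of (E, s, F) Z) \<longleftrightarrow> X \<subseteq> Z"
proof
  assume sub: "\<forall>s\<in>S. closure_of (E, s, F) X \<subseteq> closure_of (E, s, F) Z"
  obtain Y where Y: "Y \<subseteq> F" "Z = lower (E, \<Inter>S, F) Y"
    using assms(3) by auto
  have "(x, y) \<in> s" if "x \<in> X" "y \<in> Y" "s \<in> S" for x y s
  proof -
    have "x \<in> closure_of (E, s, F) X"
      using assms(2) that(1) by (auto simp: closure_of_def)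
    then have "x \<in> closure_of (E, s, F) Z"
      using sub that(3) by blast
    then show ?thesis
      using Y that(2,3) by (auto simp: closure_of_def)
  qed
  then show "X \<subseteq> Z"
    using Y assms(2) by auto
qed (auto simp: closure_of_def)

lemma Gal_in_L_S_if_F_S:
  assumes "R \<in> F_S n"
  shows "Gal R \<in> L_S n"
proof -
  obtain E \<rho> F where R: "R = (E, \<rho>, F)"
    by (cases R)
  let ?G = "Gal_carrier (E, \<rho>, F)"
  let ?Q = "\<lambda>\<rho>'. \<rho>' \<subseteq> E \<times> F \<and> chain (Gal (E, \<rho>', F)) \<and> scattered (Gal (E, \<rho>', F))"
  \<comment> \<open>Inclusion in the lattice of \<open>s\<close>, pulled back along closure.
    Distinct \<open>X\<close> may have the same closure, which causes ties.\<close>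
  let ?h = "\<lambda>s. {(X, Z) \<in> ?G \<times> ?G.
    (closure_of (E, s, F) X, closure_of (E, s, F) Z) \<in> snd (Gal (E, s, F))}"
  have "inter_of_at_most n ?Q \<rho>"
    using assms R by (auto simp: F_S_def)
  then have "inter_of_at_most n (scattered_preorder ?G) (relation_of (\<subseteq>) ?G)"
  proof (rule inter_of_at_most_map[where h = ?h])
    fix s assume "?Q s"
    then have "scattered_preorder (Gal_carrier (E, s, F)) (snd (Gal (E, s, F)))"
      using scattered_chain_Gal_iff by blast
    then show "scattered_preorder ?G (?h s)"
      by (rule scattered_preorder_pullback) (auto intro: closure_of_in_Gal_carrier simp del: Gal_carrier.simps)
  next
    fix S assume S: "S \<noteq> {}" "\<rho> = \<Inter>S"
    have h: "(X, Z) \<in> ?h s \<longleftrightarrow> X \<in> ?G \<and> Z \<in> ?G \<and> closure_of (E, s, F) X \<subseteq> closure_of (E, s, F) Z" for X Z s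
      by (simp add: Gal_def relation_of_def closure_of_in_Gal_carrier del: Gal_carrier.simps)
    have "(X, Z) \<in> relation_of (\<subseteq>) ?G \<longleftrightarrow> (\<forall>s\<in>S. (X, Z) \<in> ?h s)" for X Z
      unfolding h using closures_subset_iff[OF S(1), of X E F Z] S
      by (auto simp: relation_of_def simp del: Gal_carrier.simps)
    then show "relation_of (\<subseteq>) ?G = \<Inter>(?h ` S)"
      by (auto simp del: Gal_carrier.simps)
  qed
  then show ?thesis
    unfolding R Gal_def L_S_iff using partial_order_Gal by blast
qed

lemma F_S_if_Gal_in_L_S:
  assumes "incidence_structure R" "Gal R \<in> L_S n"
  shows "R \<in> F_S n"
proof -
  obtain E \<rho> F where R: "R = (E, \<rho>, F)"
    by (cases R)
  let ?G = "Gal_carrier (E, \<rho>, F)"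
  let ?h = "\<lambda>l. {(x, y) \<in> E \<times> F. (closure_of (E, \<rho>, F) {x}, lower (E, \<rho>, F) {y}) \<in> l}"
  have \<rho>: "\<rho> \<subseteq> E \<times> F"
    using assms(1) R by simp
  have "inter_of_at_most n (scattered_preorder ?G) (relation_of (\<subseteq>) ?G)"
    using assms(2) by (simp add: R Gal_def L_S_iff)
  then have "inter_of_at_most n
    (\<lambda>\<rho>'. \<rho>' \<subseteq> E \<times> F \<and> chain (Gal (E, \<rho>', F)) \<and> scattered (Gal (E, \<rho>', F))) \<rho>"
  proof (rule inter_of_at_most_map[where h = ?h])
    fix l assume l: "scattered_preorder ?G l"
    have "chain (Gal (E, ?h l, F)) \<and> scattered (Gal (E, ?h l, F))"
      \<comment> \<open>Attributes are ranked by their down-sets in \<open>l\<close>, so the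
        monotonicity condition is transitivity of \<open>l\<close>.\<close>
      by (rule scattered_chain_Gal_if_scattered_preorder[OF l, where \<phi> = "\<lambda>y. lower (E, \<rho>, F) {y}"])
        (auto intro: lower_in_Gal_carrier transD[OF scattered_preorderD(2)[OF l]]
          simp del: Gal_carrier.simps lower.simps)
    then show "?h l \<subseteq> E \<times> F \<and> chain (Gal (E, ?h l, F)) \<and> scattered (Gal (E, ?h l, F))"
      by blast
  next
    fix S assume S: "S \<noteq> {}" "relation_of (\<subseteq>) ?G = \<Inter>S"
    have "(x, y) \<in> \<rho> \<longleftrightarrow> (closure_of (E, \<rho>, F) {x}, lower (E, \<rho>, F) {y}) \<in> \<Inter>S"
      if "x \<in> E" "y \<in> F" for x y
      unfolding S(2)[symmetric] using that singleton_closure_subset_iff[of x E y F \<rho>]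
        closure_of_in_Gal_carrier[of "(E, \<rho>, F)" "{x}"] lower_in_Gal_carrier[of "{y}" F E \<rho>]
      by (simp add: relation_of_def del: Gal_carrier.simps lower.simps)
    with \<rho> S(1) show "\<rho> = \<Inter>(?h ` S)"
      by (auto simp del: Gal_carrier.simps lower.simps)
  qed
  with \<rho> R show ?thesis
    by (simp add: F_S_def)
qed

lemma F_S_iff: "incidence_structure R \<Longrightarrow> R \<in> F_S n \<longleftrightarrow> Gal R \<in> L_S n"
  using Gal_in_L_S_if_F_S F_S_if_Gal_in_L_S by blast

section \<open>Strict orders and the class I_S\<close>

text \<open>Removing the diagonal commutes with intersections of nonempty families.\<close>

lemma strict_incidence_in_F_S_if_I_S:
  assumes "(A, r) \<in> I_S n"
  shows "strict_incidence (A, r) \<in> F_S n"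
proof -
  have r: "partial_order_on A r" and
    i: "inter_of_at_most n (\<lambda>r'. poset (A, r') \<and> chain (Gal (strict_incidence (A, r')))
         \<and> scattered (Gal (strict_incidence (A, r')))) r"
    using assms by (simp_all add: I_S_def)
  from i have "inter_of_at_most n
    (\<lambda>\<rho>'. \<rho>' \<subseteq> A \<times> A \<and> chain (Gal (A, \<rho>', A)) \<and> scattered (Gal (A, \<rho>', A))) (r - Id)"
    by (rule inter_of_at_most_map[where h = "\<lambda>s. s - Id"])
      (auto simp: partial_order_on_def preorder_on_def)
  then show ?thesis
    using r by (fastforce simp: F_S_def partial_order_on_def preorder_on_def)
qed

text \<open>A linear extension of the Galois lattice assigns to \<open>x\<close> the interval from
  \<open>q x\<close>, the strict down-set of \<open>x\<close>, to \<open>p x\<close>, the closure of \<open>x\<close>. It may be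
  inverted, in which case \<open>p x \<le> q z\<close> does not define a strict order; since \<open>q\<close> is strictly
  increasing, adding the condition \<open>q x < q z\<close> repairs this.\<close>

lemma I_S_if_strict_incidence:
  assumes "partial_order_on A r" "Gal (strict_incidence (A, r)) \<in> L_S n"
  shows "(A, r) \<in> I_S n"
proof -
  let ?R = "(A, r - Id, A)"
  let ?G = "Gal_carrier ?R"
  define p where "p x = closure_of ?R {x}" for x
  define q where "q x = lower ?R {x}" for x
  define s where "s l = {(x, z) \<in> A \<times> A. (p x, q z) \<in> l \<and> (q x, q z) \<in> l \<and> (q z, q x) \<notin> l}" for l
  have pG: "p x \<in> ?G" for x
    unfolding p_def by (rule closure_of_in_Gal_carrier)
  have qG: "q x \<in> ?G" if "x \<in> A" for x
    unfolding q_def using that by (intro lower_in_Gal_carrier) simp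
  have pq: "p x \<subseteq> q z \<longleftrightarrow> (x, z) \<in> r - Id" if "x \<in> A" "z \<in> A" for x z
    unfolding p_def q_def using singleton_closure_subset_iff[OF that] .
  have r: "r \<subseteq> A \<times> A" "refl_on A r" "trans r" "antisym r"
    using assms(1) by (auto simp: partial_order_on_def preorder_on_def)
  \<comment> \<open>The point \<open>x\<close> witnesses properness: it lies in \<open>q z\<close>
    but not in \<open>q x\<close>.\<close>
  have qq: "q x \<subset> q z" if "(x, z) \<in> r - Id" for x z
  proof -
    have "x \<in> q z" "x \<notin> q x"
      using that r(1) by (auto simp: q_def)
    moreover have "q x \<subseteq> q z"
      using that transD[OF r(3)] antisymD[OF r(4)] by (auto simp: q_def)
    ultimately show ?thesis by blast
  qed
  \<comment> \<open>The members are kept antisymmetric here, so that \<open>q x \<noteq> q z\<close>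
    turns \<open>(q x, q z) \<in> l\<close> into a strict inequality.\<close>
  have "inter_of_at_most n (\<lambda>l. chain (?G, l) \<and> scattered (?G, l)) (relation_of (\<subseteq>) ?G)"
    using assms(2) by (simp add: Gal_def L_S_def)
  then have "inter_of_at_most n (\<lambda>r'. poset (A, r') \<and> chain (Gal (strict_incidence (A, r')))
         \<and> scattered (Gal (strict_incidence (A, r')))) r"
  proof (rule inter_of_at_most_map[where h = "\<lambda>l. s l \<union> Id_on A"])
    fix l assume "chain (?G, l) \<and> scattered (?G, l)"
    then have "scattered_preorder ?G l"
      unfolding scattered_chain_iff by blast
    note l = this scattered_preorderD(2)[OF this]
    note tr = transD[OF l(2)]
    have "trans (s l)"
    proof (rule transI)
      fix x y z
      assume "(x, y) \<in> s l" "(y, z) \<in> s l"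
      then show "(x, z) \<in> s l"
        unfolding s_def
        using tr[of "p x" "q y" "q z"] tr[of "q x" "q y" "q z"] tr[of "q y" "q z" "q x"] by blast
    qed
    moreover have "antisym (s l)"
      by (auto simp: antisym_def s_def)
    moreover have sA: "s l \<subseteq> A \<times> A"
      by (auto simp: s_def)
    ultimately have "partial_order_on A (s l \<union> Id_on A)"
      unfolding partial_order_on_def preorder_on_def trans_def antisym_def refl_on_def by auto
    moreover have strict: "s l \<union> Id_on A - Id = s l"
      by (auto simp: s_def)
    have "chain (Gal (A, s l, A)) \<and> scattered (Gal (A, s l, A))"
    \<comment> \<open>Both conditions in \<open>s l\<close> bound \<open>q y\<close> from below, one
      of them strictly, so they persist when \<open>q y\<close> is replaced by a larger
      \<open>q z\<close>.\<close>
    proof (rule scattered_chain_Gal_if_scattered_preorder[OF l(1), where \<phi> = q])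
      show "q ` A \<subseteq> ?G"
        using qG by blast
      fix x y z assume "y \<in> A" "z \<in> A" "(q y, q z) \<in> l" "(x, y) \<in> s l"
      then show "(x, z) \<in> s l"
        unfolding s_def using tr[of "p x" "q y" "q z"] tr[of "q x" "q y" "q z"] tr[of "q y" "q z" "q x"]
        by blast
    qed
    ultimately show "poset (A, s l \<union> Id_on A) \<and> chain (Gal (strict_incidence (A, s l \<union> Id_on A)))
         \<and> scattered (Gal (strict_incidence (A, s l \<union> Id_on A)))"
      by (simp add: strict del: chain.simps scattered.simps)
  next
    fix S assume S: "S \<noteq> {}" "\<forall>l\<in>S. chain (?G, l) \<and> scattered (?G, l)" "relation_of (\<subseteq>) ?G = \<Inter>S"
    have anti: "antisym l" if "l \<in> S" for l
      using S(2) that unfolding scattered_chain_iff by blast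
    have sub: "X \<subseteq> Z \<longleftrightarrow> (\<forall>l\<in>S. (X, Z) \<in> l)" if "X \<in> ?G" "Z \<in> ?G" for X Z
    proof -
      have "X \<subseteq> Z \<longleftrightarrow> (X, Z) \<in> \<Inter>S"
        unfolding S(3)[symmetric] using that by (simp add: relation_of_def del: Gal_carrier.simps)
      then show ?thesis by blast
    qed
    have "(x, z) \<in> r - Id \<longleftrightarrow> (\<forall>l\<in>S. (x, z) \<in> s l)" if "x \<in> A" "z \<in> A" for x z
    proof
      assume xz: "(x, z) \<in> r - Id"
      show "\<forall>l\<in>S. (x, z) \<in> s l"
      proof
        fix l assume l: "l \<in> S"
        have "(p x, q z) \<in> l"
          using sub[OF pG qG] pq[OF that] xz that l by blast
        moreover have "(q x, q z) \<in> l"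
          using sub[OF qG qG] qq[OF xz] that l by blast
        moreover have "q x \<noteq> q z"
          using qq[OF xz] by blast
        ultimately show "(x, z) \<in> s l"
          using antisymD[OF anti[OF l]] that by (auto simp: s_def)
      qed
    next
      assume "\<forall>l\<in>S. (x, z) \<in> s l"
      then show "(x, z) \<in> r - Id"
        using sub[OF pG qG] pq[OF that] that by (auto simp: s_def)
    qed
    note eq = this
    have "s l \<subseteq> A \<times> A" for l
      by (auto simp: s_def)
    with S(1) have "\<Inter>(s ` S) \<subseteq> A \<times> A"
      by blast
    then have "xz \<in> r - Id \<longleftrightarrow> xz \<in> \<Inter>(s ` S)" for xz
      using r(1) eq[of "fst xz" "snd xz"] by (cases "xz \<in> A \<times> A") auto
    then have "r - Id = \<Inter>(s ` S)"
      by (rule set_eqI)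
    moreover have "Id_on A \<subseteq> r" "r \<inter> Id \<subseteq> Id_on A"
      using r(1,2) by (auto simp: refl_on_def)
    ultimately have "r = \<Inter>(s ` S) \<union> Id_on A"
      by blast
    then show "r = \<Inter>((\<lambda>l. s l \<union> Id_on A) ` S)"
      by simp
  qed
  then show ?thesis
    using assms(1) by (simp add: I_S_def)
qed

lemma I_S_iff:
  assumes "poset P"
  shows "P \<in> I_S n \<longleftrightarrow> Gal (strict_incidence P) \<in> L_S n"
proof (cases P)
  case (Pair A r)
  with assms show ?thesis
    using Gal_in_L_S_if_F_S[OF strict_incidence_in_F_S_if_I_S] I_S_if_strict_incidence by auto
qed

section \<open>MacNeille completion\<close>

text \<open>Each scattered total preorder serves as its own incidence relation: with
  \<open>\<phi> = id\<close> the monotonicity condition is transitivity.\<close>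

lemma L_S_subset_F_S:
  assumes "(A, r) \<in> L_S n"
  shows "(A, r, A) \<in> F_S n"
proof -
  have r: "partial_order_on A r" and i: "inter_of_at_most n (scattered_preorder A) r"
    using assms L_S_iff by blast+
  from i have "inter_of_at_most n
    (\<lambda>\<rho>'. \<rho>' \<subseteq> A \<times> A \<and> chain (Gal (A, \<rho>', A)) \<and> scattered (Gal (A, \<rho>', A))) r"
  proof (rule inter_of_at_most_map[where h = id])
    fix s assume s: "scattered_preorder A s"
    have "chain (Gal (A, s, A)) \<and> scattered (Gal (A, s, A))"
      by (rule scattered_chain_Gal_if_scattered_preorder[OF s, where \<phi> = id])
        (auto intro: transD[OF scattered_preorderD(2)[OF s]])
    then show "id s \<subseteq> A \<times> A \<and> chain (Gal (A, id s, A)) \<and> scattered (Gal (A, id s, A))"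
      using scattered_preorderD(1)[OF s] by simp
  qed simp
  then show ?thesis
    using r by (simp add: F_S_def partial_order_on_def preorder_on_def)
qed

text \<open>The poset embeds into its completion by principal down-sets \<open>?d\<close>, and the
  preorders realizing the completion are pulled back along this embedding.\<close>

lemma L_S_if_MacNeille:
  assumes "partial_order_on A r" "MacNeille (A, r) \<in> L_S n"
  shows "(A, r) \<in> L_S n"
proof -
  let ?G = "Gal_carrier (A, r, A)"
  let ?d = "\<lambda>x. lower (A, r, A) {x}"
  have d: "?d x \<subseteq> ?d y \<longleftrightarrow> (x, y) \<in> r" if "x \<in> A" "y \<in> A" for x y
    using that assms(1) by (auto simp: partial_order_on_def preorder_on_def refl_on_def dest: transD)
  have "inter_of_at_most n (scattered_preorder ?G) (relation_of (\<subseteq>) ?G)"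
    using assms(2) by (simp add: Gal_def L_S_iff)
  then have "inter_of_at_most n (scattered_preorder A) r"
  proof (rule inter_of_at_most_map[where h = "\<lambda>l. {(x, y) \<in> A \<times> A. (?d x, ?d y) \<in> l}"])
    fix l assume "scattered_preorder ?G l"
    then show "scattered_preorder A {(x, y) \<in> A \<times> A. (?d x, ?d y) \<in> l}"
      by (rule scattered_preorder_pullback)
        (auto intro: lower_in_Gal_carrier simp del: Gal_carrier.simps lower.simps)
  next
    fix S assume S: "S \<noteq> {}" "relation_of (\<subseteq>) ?G = \<Inter>S"
    have "(x, y) \<in> r \<longleftrightarrow> (?d x, ?d y) \<in> \<Inter>S" if "x \<in> A" "y \<in> A" for x y
      unfolding S(2)[symmetric] using that d lower_in_Gal_carrier[of "{x}" A A r]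
        lower_in_Gal_carrier[of "{y}" A A r]
      by (simp add: relation_of_def del: Gal_carrier.simps lower.simps)
    moreover have "r \<subseteq> A \<times> A"
      using assms(1) by (simp add: partial_order_on_def preorder_on_def)
    ultimately show "r = \<Inter>((\<lambda>l. {(x, y) \<in> A \<times> A. (?d x, ?d y) \<in> l}) ` S)"
      using S(1) by (auto simp del: Gal_carrier.simps lower.simps)
  qed
  with assms(1) show ?thesis
    by (simp add: L_S_iff)
qed

lemma L_S_iff_MacNeille:
  assumes "poset P"
  shows "P \<in> L_S n \<longleftrightarrow> MacNeille P \<in> L_S n"
proof (cases P)
  case (Pair A r)
  with assms show ?thesis
    using Gal_in_L_S_if_F_S[OF L_S_subset_F_S] L_S_if_MacNeille by auto
qed

theorem theorem8:
  fixes n :: int and R :: "('a, 'b) incidence" and P :: "'c poset"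
  assumes "incidence_structure R" and "poset P"
  shows "(R \<in> F_S n \<longleftrightarrow> Gal R \<in> L_S n) \<and>
    (P \<in> I_S n \<longleftrightarrow> Gal (strict_incidence P) \<in> L_S n) \<and>
    (P \<in> L_S n \<longleftrightarrow> MacNeille P \<in> L_S n)"
  using F_S_iff[OF assms(1)] I_S_iff[OF assms(2)] L_S_iff_MacNeille[OF assms(2)] by blast

end
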